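(* Let $X$ be a real Banach space. Then $X$ has the Daugavet property if, and only if, for every $x\in S_X$, every non-empty subset $U$ of $S_X$ that is open for the Lip-topology, and every $\varepsilon>0$, there exists $y\in U$ such that $$\|x+y\|>2-\varepsilon.$$
   Context: $S_X$ denotes the unit sphere of $X$. $X$ has the Daugavet property if $\|I+T\|=1+\|T\|$ for every bounded linear rank-one operator $T:X\to X$, where $I$ is the identity operator. For a Lipschitz function $f:X\to\mathbb R$, let $\|f\|$ denote its (best) Lipschitz constant. A Lip-slice of $S_X$ is a non-empty set of the form $$S(S_X,f,\varepsilon):=\left\{\frac{x_1-x_2}{\|x_1-x_2\|}:\ x_1,x_2\in X,\ x_1\neq x_2,\ \frac{f(x_1)-f(x_2)}{\|x_1-x_2\|}>\|f\|-\varepsilon\right\},$$ where $f:X\to\mathbb R$ is Lipschitz and $\varepsilon>0$. The Lip-topology on $S_X$ is the topology generated by the family of all Lip-slices of $S_X$ as a subbasis. *)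

theory Defs
  imports "HOL-Analysis.Analysis"
begin

text \<open>Rank one means rank exactly one: the zero operator is excluded. An infinite-dimensional
  range has dimension \<open>0\<close> by the library's convention, so it is excluded too.\<close>

definition daugavet_property :: "'a::real_normed_vector itself \<Rightarrow> bool" where
  "daugavet_property _ \<longleftrightarrow>
     (\<forall>T :: 'a \<Rightarrow>\<^sub>L 'a. dim (range (blinfun_apply T)) = 1 \<longrightarrow>
        norm (id_blinfun + T) = 1 + norm T)"

text \<open>Only meaningful if \<open>f\<close> is Lipschitz; otherwise it is the infimum of the empty set.\<close>

definition lipschitz_const :: "('a::metric_space \<Rightarrow> 'b::metric_space) \<Rightarrow> real" where
  "lipschitz_const f = Inf {C. C-lipschitz_on UNIV f}"

definition lip_slice :: "('a::real_normed_vector \<Rightarrow> real) \<Rightarrow> real \<Rightarrow> 'a set" where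
  "lip_slice f \<epsilon> =
     {(x1 - x2) /\<^sub>R norm (x1 - x2) | x1 x2.
        x1 \<noteq> x2 \<and> (f x1 - f x2) / norm (x1 - x2) > lipschitz_const f - \<epsilon>}"

definition lip_slices :: "'a::real_normed_vector set set" where
  "lip_slices =
     {lip_slice f \<epsilon> | f \<epsilon>. (\<exists>C. C-lipschitz_on UNIV f) \<and> \<epsilon> > 0 \<and> lip_slice f \<epsilon> \<noteq> {}}"

definition lip_topology :: "'a::real_normed_vector topology" where
  "lip_topology = topology_generated_by lip_slices"

text \<open>The slices of a constant function are the whole sphere, so the slices cover it.\<close>

lemma topspace_lip_topology: "topspace lip_topology = sphere (0::'a::real_normed_vector) 1"
proof -
  have "lip_slice f \<epsilon> \<subseteq> sphere 0 1" for f :: "'a \<Rightarrow> real" and \<epsilon>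
    by (auto simp: lip_slice_def)
  hence "\<Union>lip_slices \<subseteq> sphere (0::'a) 1"
    by (auto simp: lip_slices_def)
  moreover have "u \<in> \<Union>lip_slices" if "u \<in> sphere 0 1" for u :: 'a
  proof -
    have lip: "{C. C-lipschitz_on UNIV (\<lambda>_::'a. 0::real)} = {0..}"
      by (auto simp: lipschitz_on_def)
    have const: "lipschitz_const (\<lambda>_::'a. 0::real) = 0"
      unfolding lipschitz_const_def lip by simp
    have "norm u = 1" "u \<noteq> 0"
      using that by auto
    hence u: "u \<in> lip_slice (\<lambda>_. 0) 1"
      unfolding lip_slice_def const by (intro CollectI exI[of _ u] exI[of _ 0]) simp
    moreover have "lip_slice (\<lambda>_. 0) 1 \<in> (lip_slices :: 'a set set)"
      using u lip unfolding lip_slices_def by (intro CollectI exI[of _ "\<lambda>_. 0"] exI[of _ 1]) auto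
    ultimately show ?thesis by blast
  qed
  ultimately show ?thesis
    unfolding lip_topology_def topology_generated_by_topspace by blast
qed

end

theory Submission
  imports Defs
begin

text \<open>For a Lipschitz function \<open>f\<close> the largest slope in direction \<open>w\<close>,
  \<open>p w = sup {(f (z + t w) - f z) / t | z, t > 0}\<close>, is sublinear. If \<open>u\<close> lies in a Lip-slice of \<open>f\<close>,
  the Hahn--Banach theorem gives a functional \<open>\<phi> \<le> p\<close> with \<open>\<phi> u = p u\<close>, so some slice of \<open>\<phi>\<close>
  contains \<open>u\<close> and is contained in the Lip-slice. Thus the Lip-topology on the sphere is the weak one,
  and what remains is Shvydkoy's theorem: in a space with the Daugavet property every weakly open set
  that meets the sphere contains \<open>y\<close> with \<open>norm (x + y)\<close> close to \<open>2\<close>.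

  For finitely many functionals \<open>\<phi>\<^sub>i\<close>, measure distances by \<open>sqrt (\<Sum>i. (\<phi>\<^sub>i v)\<^sup>2)\<close>. A point of the
  unit ball that is almost farthest from some centre lies in a slice of small diameter, and, with
  centres far away in a separating direction, the convex hull of these points is seen to be dense in the ball.
  So \<open>u\<close> is approximated by a convex combination of slices, from which the Daugavet property picks
  points one after the other, the norm of the partial sums being almost additive.\<close>

section \<open>Sublinear functionals and the Hahn-Banach theorem\<close>

definition sublinear :: "('a::real_vector \<Rightarrow> real) \<Rightarrow> bool" where
  "sublinear p \<longleftrightarrow> (\<forall>x y. p (x + y) \<le> p x + p y) \<and> (\<forall>c>0. \<forall>x. p (c *\<^sub>R x) \<le> c * p x)"

lemma sublinear_add: "sublinear p \<Longrightarrow> p (x + y) \<le> p x + p y"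
  by (simp add: sublinear_def)

lemma sublinear_scaleR:
  assumes "sublinear p" "c > 0"
  shows "p (c *\<^sub>R x) = c * p x"
proof -
  have "p ((1 / c) *\<^sub>R (c *\<^sub>R x)) \<le> (1 / c) * p (c *\<^sub>R x)"
    using assms unfolding sublinear_def by (metis zero_less_divide_1_iff)
  hence "c * p x \<le> p (c *\<^sub>R x)"
    using assms(2) by (simp add: field_simps)
  moreover have "p (c *\<^sub>R x) \<le> c * p x"
    using assms by (simp add: sublinear_def)
  ultimately show ?thesis by simp
qed

lemma sublinear_zero:
  assumes "sublinear p"
  shows "p 0 = 0"
  using sublinear_scaleR[OF assms, of 2 0] by simp

lemma sublinear_minus_le:
  assumes "sublinear p"
  shows "- p (- x) \<le> p x"
  using sublinear_add[OF assms, of x "- x"] sublinear_zero[OF assms] by simp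

text \<open>A sublinear functional dominates its reducts, and a minimal one, being equal to all of them,
  is additive. The reduct in direction \<open>v\<close> also forces the value \<open>p v\<close> at \<open>v\<close>.\<close>

definition sublinear_reduct :: "('a::real_vector \<Rightarrow> real) \<Rightarrow> 'a \<Rightarrow> 'a \<Rightarrow> real" where
  "sublinear_reduct p v z = (INF t\<in>{0..}. p (z + t *\<^sub>R v) - t * p v)"

text \<open>Subadditivity at \<open>z + s *\<^sub>R v\<close> and \<open>- z\<close> bounds every
  term below by \<open>- p (- z)\<close>, so the \<open>INF\<close> is a true infimum.\<close>

lemma sublinear_reduct_le:
  assumes "sublinear p" "t \<ge> 0"
  shows "sublinear_reduct p v z \<le> p (z + t *\<^sub>R v) - t * p v"
proof -
  have "- p (- z) \<le> p (z + s *\<^sub>R v) - s * p v" if "s \<ge> 0" for s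
  proof -
    have "p (s *\<^sub>R v) \<le> p (z + s *\<^sub>R v) + p (- z)"
      using sublinear_add[OF assms(1), of "z + s *\<^sub>R v" "- z"] by simp
    moreover have "p (s *\<^sub>R v) = s * p v"
      using that sublinear_scaleR[OF assms(1)] sublinear_zero[OF assms(1)] by (cases "s = 0") auto
    ultimately show ?thesis by simp
  qed
  hence "bdd_below ((\<lambda>t. p (z + t *\<^sub>R v) - t * p v) ` {0..})"
    by (intro bdd_belowI2) auto
  thus ?thesis
    unfolding sublinear_reduct_def using assms(2) by (intro cINF_lower) auto
qed

lemma sublinear_reduct_greatest:
  "(\<And>t. t \<ge> 0 \<Longrightarrow> m \<le> p (z + t *\<^sub>R v) - t * p v) \<Longrightarrow> m \<le> sublinear_reduct p v z"
  unfolding sublinear_reduct_def by (intro cINF_greatest) auto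

lemma sublinear_sublinear_reduct:
  assumes "sublinear p"
  shows "sublinear (sublinear_reduct p v)"
  unfolding sublinear_def
proof (intro conjI allI impI)
  let ?q = "sublinear_reduct p v"
  fix x y
  \<comment> \<open>Parameters \<open>s\<close> for \<open>x\<close> and \<open>t\<close> for
    \<open>y\<close> add up to an admissible one for \<open>x + y\<close>; the infima over
    \<open>t\<close> and \<open>s\<close> are then taken in turn.\<close>
  have "?q (x + y) \<le> (p (x + s *\<^sub>R v) - s * p v) + (p (y + t *\<^sub>R v) - t * p v)"
    if "s \<ge> 0" "t \<ge> 0" for s t
  proof -
    have "?q (x + y) \<le> p ((x + y) + (s + t) *\<^sub>R v) - (s + t) * p v"
      using that by (intro sublinear_reduct_le[OF assms]) auto
    moreover have "(x + y) + (s + t) *\<^sub>R v = (x + s *\<^sub>R v) + (y + t *\<^sub>R v)"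
      by (simp add: scaleR_add_left)
    ultimately show ?thesis
      using sublinear_add[OF assms, of "x + s *\<^sub>R v" "y + t *\<^sub>R v"] by (simp add: algebra_simps)
  qed
  hence "?q (x + y) - (p (x + s *\<^sub>R v) - s * p v) \<le> ?q y" if "s \<ge> 0" for s
    using that by (intro sublinear_reduct_greatest) (force simp: algebra_simps)
  hence "?q (x + y) - ?q y \<le> ?q x"
    by (intro sublinear_reduct_greatest) (force simp: algebra_simps)
  thus "?q (x + y) \<le> ?q x + ?q y" by simp
next
  let ?q = "sublinear_reduct p v"
  fix c :: real and x
  assume c: "c > 0"
  have "(1 / c) * ?q (c *\<^sub>R x) \<le> p (x + t *\<^sub>R v) - t * p v" if "t \<ge> 0" for t
  proof -
    have "?q (c *\<^sub>R x) \<le> p (c *\<^sub>R x + (c * t) *\<^sub>R v) - (c * t) * p v"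
      using that c by (intro sublinear_reduct_le[OF assms]) auto
    also have "c *\<^sub>R x + (c * t) *\<^sub>R v = c *\<^sub>R (x + t *\<^sub>R v)"
      by (simp add: scaleR_add_right)
    also have "p \<dots> = c * p (x + t *\<^sub>R v)"
      by (rule sublinear_scaleR[OF assms c])
    finally show ?thesis
      using c by (simp add: field_simps)
  qed
  hence "(1 / c) * ?q (c *\<^sub>R x) \<le> ?q x"
    by (rule sublinear_reduct_greatest)
  thus "?q (c *\<^sub>R x) \<le> c * ?q x"
    using c by (simp add: field_simps)
qed

text \<open>The common lower bound \<open>- p (- x)\<close> makes the pointwise infimum finite.
  Subadditivity uses comparability: the smaller of two members lies below both and can replace
  them.\<close>

lemma sublinear_INF_chain:
  assumes ne: "\<Q> \<noteq> {}" and sub: "\<And>q. q \<in> \<Q> \<Longrightarrow> sublinear q"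
    and le: "\<And>q x. q \<in> \<Q> \<Longrightarrow> q x \<le> p x"
    and chain: "\<And>q r. q \<in> \<Q> \<Longrightarrow> r \<in> \<Q> \<Longrightarrow> q \<le> r \<or> r \<le> q"
  shows "sublinear (\<lambda>x. INF q\<in>\<Q>. q x)" and "q \<in> \<Q> \<Longrightarrow> (INF q\<in>\<Q>. q x) \<le> q x"
proof -
  have "- p (- x) \<le> q x" if "q \<in> \<Q>" for q x
    using sublinear_minus_le[OF sub[OF that], of x] le[OF that, of "- x"] by simp
  hence bdd: "bdd_below ((\<lambda>q. q x) ` \<Q>)" for x
    by (intro bdd_belowI2) auto
  have lower: "(INF q\<in>\<Q>. q x) \<le> q x" if "q \<in> \<Q>" for q x
    using bdd that by (rule cINF_lower)
  show "(INF q\<in>\<Q>. q x) \<le> q x" if "q \<in> \<Q>"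
    using that by (rule lower)
  show "sublinear (\<lambda>x. INF q\<in>\<Q>. q x)"
    unfolding sublinear_def
  proof (intro conjI allI impI)
    fix x y
    have "(INF q\<in>\<Q>. q (x + y)) \<le> q x + r y" if qr: "q \<in> \<Q>" "r \<in> \<Q>" for q r
    proof -
      obtain s where s: "s \<in> \<Q>" "s x \<le> q x" "s y \<le> r y"
        using chain[OF qr] qr by (auto simp: le_fun_def)
      have "(INF q\<in>\<Q>. q (x + y)) \<le> s (x + y)"
        using s by (intro lower)
      also have "\<dots> \<le> s x + s y"
        using sub[OF s(1)] by (rule sublinear_add)
      finally show ?thesis using s by simp
    qed
    hence "(INF q\<in>\<Q>. q (x + y)) - q x \<le> (INF r\<in>\<Q>. r y)" if "q \<in> \<Q>" for q
      using that by (intro cINF_greatest ne) (force simp: algebra_simps)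
    hence "(INF q\<in>\<Q>. q (x + y)) - (INF r\<in>\<Q>. r y) \<le> (INF q\<in>\<Q>. q x)"
      by (intro cINF_greatest ne) (force simp: algebra_simps)
    thus "(INF q\<in>\<Q>. q (x + y)) \<le> (INF q\<in>\<Q>. q x) + (INF q\<in>\<Q>. q y)" by simp
  next
    fix c :: real and x
    assume c: "c > 0"
    have "(1 / c) * (INF q\<in>\<Q>. q (c *\<^sub>R x)) \<le> (INF q\<in>\<Q>. q x)"
    proof (intro cINF_greatest ne)
      fix q assume q: "q \<in> \<Q>"
      show "(1 / c) * (INF q\<in>\<Q>. q (c *\<^sub>R x)) \<le> q x"
        using lower[OF q, of "c *\<^sub>R x"] c
        by (simp add: sublinear_scaleR[OF sub[OF q] c] field_simps)
    qed
    thus "(INF q\<in>\<Q>. q (c *\<^sub>R x)) \<le> c * (INF q\<in>\<Q>. q x)"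
      using c by (simp add: field_simps)
  qed
qed

text \<open>Zorn's lemma, for the reversed order, yields a minimal sublinear functional below the
  reduct of \<open>p\<close> in direction \<open>v\<close>. Minimality makes it linear; starting
  from the reduct rather than from \<open>p\<close> fixes its value at \<open>v\<close>.\<close>

theorem hahn_banach_sublinear:
  fixes p :: "'a::real_vector \<Rightarrow> real"
  assumes p: "sublinear p"
  obtains g where "linear g" "\<And>x. g x \<le> p x" "g v = p v"
proof -
  define p' where "p' = sublinear_reduct p v"
  define A where "A = {q. sublinear q \<and> q \<le> p'}"
  have p': "sublinear p'"
    unfolding p'_def using p by (rule sublinear_sublinear_reduct)
  have "\<exists>m\<in>A. \<forall>q\<in>A. q \<le> m \<longrightarrow> q = m"
  proof (rule predicate_Zorn)
    show "partial_order_on A (relation_of (\<lambda>f g. g \<le> f) A)"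
      by (rule partial_order_on_relation_ofI) auto
    fix \<Q> assume Q: "\<Q> \<in> Chains (relation_of (\<lambda>f g. g \<le> f) A)"
    show "\<exists>u\<in>A. \<forall>a\<in>\<Q>. u \<le> a"
    proof (cases "\<Q> = {}")
      case True
      thus ?thesis using p' by (auto simp: A_def)
    next
      case False
      have QA: "\<Q> \<subseteq> A" and chain: "\<And>q r. q \<in> \<Q> \<Longrightarrow> r \<in> \<Q> \<Longrightarrow> q \<le> r \<or> r \<le> q"
        using Q by (auto simp: Chains_def relation_of_def)
      have sub: "\<And>q. q \<in> \<Q> \<Longrightarrow> sublinear q" and le: "\<And>q x. q \<in> \<Q> \<Longrightarrow> q x \<le> p' x"
        using QA by (auto simp: A_def le_fun_def)
      let ?i = "\<lambda>x. INF q\<in>\<Q>. q x"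
      have i: "sublinear ?i" "\<And>q x. q \<in> \<Q> \<Longrightarrow> ?i x \<le> q x"
        using sublinear_INF_chain[where \<Q> = \<Q> and p = p'] False sub le chain by blast+
      obtain q where "q \<in> \<Q>" using False by blast
      hence "?i x \<le> p' x" for x
        using i(2)[of q x] le[of q x] by linarith
      thus ?thesis
        using i by (intro bexI[of _ ?i]) (auto simp: A_def le_fun_def)
    qed
  qed
  then obtain m where m: "m \<in> A" and min: "\<And>q. q \<in> A \<Longrightarrow> q \<le> m \<Longrightarrow> q = m"
    by blast
  have sub: "sublinear m" and le: "\<And>x. m x \<le> p' x"
    using m by (auto simp: A_def le_fun_def)
  have add: "m (z + w) = m z + m w" for z w
  proof -
    \<comment> \<open>The reduct of \<open>m\<close> is in \<open>A\<close> and below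
      \<open>m\<close>, so by minimality it is \<open>m\<close>; its term for \<open>t = 1\<close>
      gives superadditivity.\<close>
    have "sublinear_reduct m w \<le> m"
      using sublinear_reduct_le[OF sub, of 0] by (auto simp: le_fun_def)
    moreover have "sublinear_reduct m w \<in> A"
      using m calculation sublinear_sublinear_reduct[OF sub] by (auto simp: A_def)
    ultimately have "sublinear_reduct m w = m"
      by (intro min)
    hence "m z \<le> m (z + w) - m w"
      using sublinear_reduct_le[OF sub, of 1 w z] by simp
    thus ?thesis
      using sublinear_add[OF sub, of z w] by simp
  qed
  have minus: "m (- x) = - m x" for x
    using add[of x "- x"] sublinear_zero[OF sub] by simp
  have "m (c *\<^sub>R x) = c *\<^sub>R m x" for c x
  proof (cases c "0::real" rule: linorder_cases)
    case less
    have "m (- ((- c) *\<^sub>R x)) = - ((- c) * m x)"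
      unfolding minus using less sublinear_scaleR[OF sub, of "- c"] by simp
    thus ?thesis by simp
  qed (use sublinear_zero[OF sub] sublinear_scaleR[OF sub] in auto)
  hence "linear m"
    using add by (intro linearI) auto
  moreover have mp: "m x \<le> p x" for x
    using le[of x] sublinear_reduct_le[OF p, of 0 v x] by (simp add: p'_def)
  \<comment> \<open>The reduct at \<open>- v\<close> is at most its term for \<open>t = 1\<close>,
    which is \<open>p 0 - p v = - p v\<close>; hence \<open>m v \<ge> p v\<close>.\<close>
  moreover have "m v = p v"
    using le[of "- v"] sublinear_reduct_le[OF p, of 1 v "- v"] mp[of v]
    by (simp add: p'_def minus sublinear_zero[OF p])
  ultimately show ?thesis using that by blast
qed

section \<open>Lip-slices and slices of linear functionals\<close>

lemma lip_slice_linear_slice: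
  fixes f :: "'a::real_normed_vector \<Rightarrow> real"
  assumes lip: "C-lipschitz_on UNIV f" and u: "u \<in> lip_slice f \<epsilon>"
  obtains \<phi> :: "'a \<Rightarrow>\<^sub>L real" and \<beta>
  where "\<phi> u > \<beta>" "\<And>y. norm y = 1 \<Longrightarrow> \<phi> y > \<beta> \<Longrightarrow> y \<in> lip_slice f \<epsilon>"
proof -
  define \<beta> where "\<beta> = lipschitz_const f - \<epsilon>"
  define s where "s w = (\<lambda>(z, t). (f (z + t *\<^sub>R w) - f z) / t)" for w
  define p where "p w = (SUP k\<in>UNIV \<times> {0<..}. s w k)" for w
  have ne: "(UNIV :: 'a set) \<times> {0::real<..} \<noteq> {}" by auto
  have s_le: "s w k \<le> C * norm w" if k: "k \<in> UNIV \<times> {0<..}" for w k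
  proof -
    obtain z t where zt: "k = (z, t)" "t > 0" using k by auto
    have "\<bar>f (z + t *\<^sub>R w) - f z\<bar> \<le> C * norm (t *\<^sub>R w)"
      using lipschitz_onD[OF lip, of "z + t *\<^sub>R w" z] by (simp add: dist_norm)
    thus ?thesis using zt by (simp add: s_def field_simps)
  qed
  have upper: "s w k \<le> p w" if "k \<in> UNIV \<times> {0<..}" for w k
    unfolding p_def using that s_le by (intro cSUP_upper bdd_aboveI2) auto
  have p_le: "p w \<le> C * norm w" for w
    unfolding p_def using s_le by (intro cSUP_least ne)
  have "sublinear p"
    unfolding sublinear_def
  proof (intro conjI allI impI)
    fix v w
    have "s (v + w) (z, t) \<le> p v + p w" if "t > 0" for z t
    proof -
      \<comment> \<open>The increment along \<open>v + w\<close> is split at the intermediate point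
        \<open>z + t *\<^sub>R v\<close>, the base point of the second slope.\<close>
      have "s (v + w) (z, t) = s v (z, t) + s w (z + t *\<^sub>R v, t)"
        using that by (simp add: s_def scaleR_add_right add.assoc add_divide_distrib[symmetric])
      thus ?thesis
        using upper[of "(z, t)" v] upper[of "(z + t *\<^sub>R v, t)" w] that by auto
    qed
    thus "p (v + w) \<le> p v + p w"
      unfolding p_def[of "v + w"] by (intro cSUP_least ne) auto
  next
    fix c :: real and w
    assume c: "c > 0"
    have "s (c *\<^sub>R w) (z, t) \<le> c * p w" if "t > 0" for z t
    proof -
      have "s (c *\<^sub>R w) (z, t) = c * s w (z, t * c)"
        using that c by (simp add: s_def)
      thus ?thesis
        using upper[of "(z, t * c)" w] that c by auto
    qed
    thus "p (c *\<^sub>R w) \<le> c * p w"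
      unfolding p_def[of "c *\<^sub>R w"] by (intro cSUP_least ne) auto
  qed
  then obtain g where g: "linear g" "\<And>x. g x \<le> p x" "g u = p u"
    using hahn_banach_sublinear by blast
  have "norm (g x) \<le> norm x * C" for x
    using g(2)[of x] g(2)[of "- x"] p_le[of x] p_le[of "- x"]
    by (simp add: linear_neg[OF g(1)] mult.commute abs_le_iff)
  hence "bounded_linear g"
    using g(1) by (intro bounded_linear_intro[of _ C]) (auto simp: linear_add linear_scale)
  hence ap: "blinfun_apply (Blinfun g) = g"
    by (rule bounded_linear_Blinfun_apply)
  \<comment> \<open>The two points that put \<open>u\<close> in the Lip-slice give a slope in
    direction \<open>u\<close> with step \<open>norm (x1 - x2)\<close>, so \<open>p u\<close>, and
    with it \<open>g u\<close>, exceeds \<open>\<beta>\<close>.\<close>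
  obtain x1 x2 where x: "x1 \<noteq> x2" "u = (x1 - x2) /\<^sub>R norm (x1 - x2)"
      "(f x1 - f x2) / norm (x1 - x2) > \<beta>"
    using u by (auto simp: lip_slice_def \<beta>_def)
  have "s u (x2, norm (x1 - x2)) > \<beta>"
    using x by (simp add: s_def)
  moreover have "s u (x2, norm (x1 - x2)) \<le> p u"
    using x(1) by (intro upper) auto
  ultimately have "Blinfun g u > \<beta>"
    using g(3) ap by simp
  moreover have "y \<in> lip_slice f \<epsilon>" if y: "norm y = 1" "Blinfun g y > \<beta>" for y
  proof -
    \<comment> \<open>Conversely, if the supremum exceeds \<open>\<beta>\<close>, so does a single
      slope in direction \<open>y\<close>, and its end points put \<open>y\<close> in the
      Lip-slice.\<close>
    have "\<beta> < p y"
      using y(2) g(2)[of y] ap by simp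
    then obtain z t where t: "t > 0" "\<beta> < s y (z, t)"
      unfolding p_def using s_le less_cSUP_iff[OF ne, of "s y" \<beta>]
      by (metis (no_types, lifting) bdd_aboveI2 SigmaE greaterThan_iff)
    thus ?thesis
      unfolding lip_slice_def using y(1)
      by (intro CollectI exI[of _ "z + t *\<^sub>R y"] exI[of _ z]) (auto simp: s_def \<beta>_def)
  qed
  ultimately show ?thesis using that by blast
qed

text \<open>Induction on the generation of \<open>U\<close>: an intersection joins two finite
  families, a union takes the family of one member containing \<open>u\<close>, and a Lip-slice
  contributes a single slice.\<close>

lemma openin_lip_topology_linear_slices:
  fixes U :: "'a::real_normed_vector set"
  assumes "openin lip_topology U" "u \<in> U"
  obtains \<Phi> :: "(('a \<Rightarrow>\<^sub>L real) \<times> real) set"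
  where "finite \<Phi>" "\<forall>k\<in>\<Phi>. blinfun_apply (fst k) u > snd k"
    "\<And>y. norm y = 1 \<Longrightarrow> \<forall>k\<in>\<Phi>. blinfun_apply (fst k) y > snd k \<Longrightarrow> y \<in> U"
proof -
  have "generate_topology_on lip_slices U"
    using assms(1) by (simp add: lip_topology_def openin_topology_generated_by_iff)
  hence "\<exists>\<Phi>::(('a \<Rightarrow>\<^sub>L real) \<times> real) set. finite \<Phi> \<and>
      (\<forall>k\<in>\<Phi>. blinfun_apply (fst k) u > snd k) \<and>
      (\<forall>y. norm y = 1 \<and> (\<forall>k\<in>\<Phi>. blinfun_apply (fst k) y > snd k) \<longrightarrow> y \<in> U)"
    using assms(2)
  proof (induction rule: generate_topology_on.induct)
    case (Int a b)
    then obtain \<Phi> \<Psi> :: "(('a \<Rightarrow>\<^sub>L real) \<times> real) set"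
      where "finite \<Phi>" "\<forall>k\<in>\<Phi>. blinfun_apply (fst k) u > snd k"
        "\<forall>y. norm y = 1 \<and> (\<forall>k\<in>\<Phi>. blinfun_apply (fst k) y > snd k) \<longrightarrow> y \<in> a"
        "finite \<Psi>" "\<forall>k\<in>\<Psi>. blinfun_apply (fst k) u > snd k"
        "\<forall>y. norm y = 1 \<and> (\<forall>k\<in>\<Psi>. blinfun_apply (fst k) y > snd k) \<longrightarrow> y \<in> b"
      by auto
    thus ?case by (intro exI[of _ "\<Phi> \<union> \<Psi>"]) blast
  next
    case (UN K)
    then obtain k where "k \<in> K" "u \<in> k" by blast
    with UN.IH[OF this] show ?case by blast
  next
    case (Basis S)
    then obtain f \<epsilon> C where S: "S = lip_slice f \<epsilon>" "C-lipschitz_on UNIV f"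
      by (auto simp: lip_slices_def)
    with Basis obtain \<phi> :: "'a \<Rightarrow>\<^sub>L real" and \<beta> where
      "\<phi> u > \<beta>" "\<And>y. norm y = 1 \<Longrightarrow> \<phi> y > \<beta> \<Longrightarrow> y \<in> S"
      using lip_slice_linear_slice by (metis (no_types, lifting))
    thus ?case by (intro exI[of _ "{(\<phi>, \<beta>)}"]) auto
  qed auto
  thus ?thesis using that by blast
qed

section \<open>Small slices of the unit ball for a seminorm given by functionals\<close>

definition gram :: "('a::real_normed_vector \<Rightarrow>\<^sub>L real) set \<Rightarrow> 'a \<Rightarrow> 'a \<Rightarrow> real" where
  "gram F v w = (\<Sum>\<phi>\<in>F. blinfun_apply \<phi> v * blinfun_apply \<phi> w)"

lemma gram_simps:
  "gram F (u + v) w = gram F u w + gram F v w"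
  "gram F w (u + v) = gram F w u + gram F w v"
  "gram F (u - v) w = gram F u w - gram F v w"
  "gram F w (u - v) = gram F w u - gram F w v"
  "gram F (c *\<^sub>R v) w = c * gram F v w"
  "gram F w (c *\<^sub>R v) = c * gram F w v"
  by (simp_all add: gram_def blinfun.bilinear_simps algebra_simps sum.distrib sum_subtractf
      sum_distrib_left)

lemma gram_commute: "gram F v w = gram F w v"
  by (simp add: gram_def mult.commute)

lemma gram_square_add_scaleR:
  "gram F (v + c *\<^sub>R w) (v + c *\<^sub>R w) = gram F v v + c * (2 * gram F w v) + c * (c * gram F w w)"
  using gram_commute[of F v w] by (simp add: gram_simps algebra_simps)

lemma gram_le:
  "gram F v v \<le> (\<Sum>\<phi>\<in>F. (norm \<phi>)\<^sup>2) * (norm v)\<^sup>2"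
proof -
  have "blinfun_apply \<phi> v * blinfun_apply \<phi> v \<le> (norm \<phi>)\<^sup>2 * (norm v)\<^sup>2" for \<phi> :: "'a \<Rightarrow>\<^sub>L real"
    using power_mono[OF norm_blinfun[of \<phi> v], of 2]
    by (simp add: power2_eq_square mult_ac)
  thus ?thesis
    unfolding gram_def sum_distrib_right by (intro sum_mono)
qed

lemma gram_less_imp:
  assumes "finite F" "gram F v v < \<delta>\<^sup>2" "\<delta> > 0" "\<phi> \<in> F"
  shows "\<bar>blinfun_apply \<phi> v\<bar> < \<delta>"
proof -
  have "(blinfun_apply \<phi> v)\<^sup>2 \<le> gram F v v"
    unfolding gram_def power2_eq_square using assms by (intro member_le_sum) auto
  hence "\<bar>blinfun_apply \<phi> v\<bar>\<^sup>2 < \<delta>\<^sup>2"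
    using assms(2) by simp
  thus ?thesis
    by (rule power2_less_imp_less) (use assms(3) in simp)
qed

text \<open>Approximate denting points of the unit ball for the seminorm of \<open>F\<close>;
  \<open>\<delta>\<close> bounds a squared distance.\<close>

definition dented :: "('a::real_normed_vector \<Rightarrow>\<^sub>L real) set \<Rightarrow> real \<Rightarrow> 'a set" where
  "dented F \<delta> = {y \<in> cball 0 1. \<exists>\<psi> :: 'a \<Rightarrow>\<^sub>L real. \<exists>\<beta>. blinfun_apply \<psi> y > \<beta> \<and>
     (\<forall>z\<in>cball 0 1. blinfun_apply \<psi> z > \<beta> \<longrightarrow> gram F (z - y) (z - y) < \<delta>)}"

text \<open>With \<open>\<psi> = gram F (y0 - c)\<close>, the squared distance of \<open>y\<close>
  from \<open>y0\<close> is the gain in squared distance from \<open>c\<close> minus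
  \<open>2 * (\<psi> y - \<psi> y0)\<close>. On the slice this is less than
  \<open>\<delta> / 3 + 2 * \<delta> / 3\<close>.\<close>

lemma near_farthest_dented:
  assumes y0: "y0 \<in> cball 0 1" and \<delta>: "\<delta> > 0"
    and far: "\<And>y. y \<in> cball 0 1 \<Longrightarrow> gram F (y - c) (y - c) < gram F (y0 - c) (y0 - c) + \<delta> / 3"
  shows "y0 \<in> dented F \<delta>"
proof -
  define \<psi> where "\<psi> = (\<Sum>\<phi>\<in>F. blinfun_apply \<phi> (y0 - c) *\<^sub>R \<phi>)"
  have \<psi>: "blinfun_apply \<psi> y = gram F (y0 - c) y" for y
    unfolding \<psi>_def gram_def by (simp add: blinfun.sum_left blinfun.scaleR_left)
  have "gram F (y - y0) (y - y0) < \<delta>"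
    if "y \<in> cball 0 1" "blinfun_apply \<psi> y > blinfun_apply \<psi> y0 - \<delta> / 3" for y
    using far[OF that(1)] that(2) gram_commute[of F c y] gram_commute[of F c y0]
      gram_commute[of F y0 y]
    unfolding \<psi> by (simp add: gram_simps)
  thus ?thesis
    unfolding dented_def using y0 \<delta>
    by (intro CollectI conjI exI[of _ \<psi>] exI[of _ "blinfun_apply \<psi> y0 - \<delta> / 3"]) auto
qed

text \<open>The supremum over the ball is finite by \<open>gram_le\<close> but may not be attained,
  hence the tolerance \<open>\<tau>\<close>.\<close>

lemma near_farthest_exists:
  assumes "\<tau> > 0"
  obtains y0 where "y0 \<in> cball 0 1"
    "\<And>y. y \<in> cball 0 1 \<Longrightarrow> gram F (y - c) (y - c) < gram F (y0 - c) (y0 - c) + \<tau>"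
proof -
  let ?q = "\<lambda>y. gram F (y - c) (y - c)"
  have "?q y \<le> (\<Sum>\<phi>\<in>F. (norm \<phi>)\<^sup>2) * (1 + norm c)\<^sup>2" if "y \<in> cball 0 1" for y
  proof -
    have "norm (y - c) \<le> 1 + norm c"
      using that norm_triangle_ineq4[of y c] by simp
    hence "(norm (y - c))\<^sup>2 \<le> (1 + norm c)\<^sup>2"
      by (intro power_mono) auto
    thus ?thesis
      using gram_le[of F "y - c"] by (meson mult_left_mono order_trans sum_nonneg zero_le_power2)
  qed
  hence bdd: "bdd_above (?q ` cball 0 1)"
    by (intro bdd_aboveI2) auto
  have "(SUP y\<in>cball 0 1. ?q y) - \<tau> < (SUP y\<in>cball 0 1. ?q y)"
    using assms by simp
  then obtain y0 where "y0 \<in> cball 0 1" "(SUP y\<in>cball 0 1. ?q y) - \<tau> < ?q y0"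
    using less_cSUP_iff[OF _ bdd] by auto
  moreover have "?q y \<le> (SUP y\<in>cball 0 1. ?q y)" if "y \<in> cball 0 1" for y
    using bdd that by (intro cSUP_upper)
  ultimately show ?thesis
    using that by (smt (verit))
qed

text \<open>If \<open>u\<close> kept squared distance \<open>s\<close> from the hull, some
  \<open>a\<close> would separate them. From a centre far away in direction \<open>- a\<close>,
  \<open>u\<close> is farther than every point of the hull, although an almost farthest point of the
  ball is dented and so in the hull.\<close>

lemma convex_hull_dented_dense:
  fixes F :: "('a::real_normed_vector \<Rightarrow>\<^sub>L real) set"
  assumes u: "norm u \<le> 1" and \<delta>: "\<delta> > 0" and s: "s > 0"
  shows "\<exists>w\<in>convex hull dented F \<delta>. gram F (u - w) (u - w) < s"
proof (rule ccontr)
  define H where "H = convex hull dented F \<delta>"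
  define q where "q v = gram F v v" for v
  assume "\<not> ?thesis"
  hence far: "q (u - w) \<ge> s" if "w \<in> H" for w
    using that by (auto simp: H_def q_def not_less)
  have "dented F \<delta> \<subseteq> cball 0 1"
    by (auto simp: dented_def)
  hence H1: "H \<subseteq> cball 0 1"
    unfolding H_def by (intro hull_minimal) auto
  define R where "R = 4 * (\<Sum>\<phi>\<in>F. (norm \<phi>)\<^sup>2) + s"
  have K: "(\<Sum>\<phi>\<in>F. (norm \<phi>)\<^sup>2) \<ge> 0"
    by (intro sum_nonneg) auto
  have R: "q (v - w) \<le> R" if "v \<in> cball 0 1" "w \<in> cball 0 1" for v w
  proof -
    have "norm (v - w) \<le> 2"
      using that norm_triangle_ineq4[of v w] by simp
    hence "(norm (v - w))\<^sup>2 \<le> 2\<^sup>2"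
      by (intro power_mono) auto
    hence "(\<Sum>\<phi>\<in>F. (norm \<phi>)\<^sup>2) * (norm (v - w))\<^sup>2 \<le> (\<Sum>\<phi>\<in>F. (norm \<phi>)\<^sup>2) * 4"
      using K by (intro mult_left_mono) auto
    thus ?thesis
      using gram_le[of F "v - w"] s by (simp add: q_def R_def)
  qed
  have R0: "R > 0" "s \<le> R" using K s by (auto simp: R_def)
  \<comment> \<open>Moving from \<open>w\<close> by a fraction \<open>t\<close> towards a point of
    the hull has a second-order cost of at most \<open>t * t * R = t * s / 2\<close>, which equals
    the slack in the choice of \<open>w\<close>.\<close>
  define t where "t = s / (2 * R)"
  have t: "t > 0" "t \<le> 1" "t * R = s / 2" using R0 s by (auto simp: t_def field_simps)
  obtain y1 where "y1 \<in> dented F \<delta>"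
    using near_farthest_exists[of "\<delta> / 3" F 0] near_farthest_dented[of _ \<delta> F 0] \<delta>
    by (metis divide_pos_pos zero_less_numeral)
  hence H0: "H \<noteq> {}" unfolding H_def using hull_inc by force
  define m where "m = (INF w\<in>H. q (u - w))"
  have bdd: "bdd_below ((\<lambda>w. q (u - w)) ` H)"
    using far by (intro bdd_belowI2) auto
  have "m < m + t * s / 2" using t s by simp
  then obtain w where w: "w \<in> H" "q (u - w) < m + t * s / 2"
    using cINF_less_iff[OF H0 bdd, of "m + t * s / 2"] unfolding m_def[symmetric] by blast
  have m: "m \<le> q (u - w')" if "w' \<in> H" for w'
    unfolding m_def using bdd that by (intro cINF_lower)
  define a where "a = u - w"
  \<comment> \<open>\<open>w\<close> is almost the point of \<open>H\<close> nearest to \<open>u\<close>, so \<open>a\<close> separates \<open>u\<close> from \<open>H\<close>.\<close>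
  have sep: "gram F a (d - u) < - s / 2" if d: "d \<in> H" for d
  proof -
    have "(1 - t) *\<^sub>R w + t *\<^sub>R d \<in> H"
      using w(1) d t unfolding H_def by (intro convexD convex_convex_hull) auto
    hence "m \<le> q (u - ((1 - t) *\<^sub>R w + t *\<^sub>R d))" by (rule m)
    also have "u - ((1 - t) *\<^sub>R w + t *\<^sub>R d) = a - t *\<^sub>R (d - w)"
      by (simp add: a_def algebra_simps)
    also have "q \<dots> = q a - 2 * t * gram F a (d - w) + t * (t * q (d - w))"
      using gram_square_add_scaleR[of F a "- t" "d - w"] gram_commute[of F "d - w" a]
      by (simp add: q_def)
    also have "t * (t * q (d - w)) \<le> t * (t * R)"
      using R[of d w] subsetD[OF H1 d] subsetD[OF H1 w(1)] t by (intro mult_left_mono) auto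
    also have "t * (t * R) = t * s / 2" using t by simp
    finally have "t * (2 * gram F a (d - w)) < t * s"
      using w(2) by (simp add: a_def)
    hence "gram F a (d - w) < s / 2" using t by simp
    moreover have "gram F a (d - u) = gram F a (d - w) - q a"
      by (simp add: a_def q_def gram_simps)
    ultimately show ?thesis using far[OF w(1)] by (simp add: a_def)
  qed
  \<comment> \<open>The linear term \<open>- M * s = - (R + 1)\<close> outweighs the quadratic one,
    at most \<open>R\<close>, by \<open>1\<close>. The tolerance for \<open>y0\<close> below is at
    most \<open>1\<close> for this reason and at most \<open>\<delta> / 3\<close> to make
    \<open>y0\<close> dented.\<close>
  define M where "M = (R + 1) / s"
  have M: "M > 0" "M * s = R + 1" using R0 s by (auto simp: M_def)
  define c where "c = u - M *\<^sub>R a"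
  obtain y0 where y0: "y0 \<in> cball 0 1"
    and y0_far: "\<And>y. y \<in> cball 0 1 \<Longrightarrow> q (y - c) < q (y0 - c) + min (\<delta> / 3) 1"
    using near_farthest_exists[of "min (\<delta> / 3) 1" F c] \<delta> unfolding q_def by auto
  have "y0 \<in> dented F \<delta>"
    using y0_far \<delta> unfolding q_def by (intro near_farthest_dented[of _ _ F c] y0) (force+)
  hence y0H: "y0 \<in> H" unfolding H_def by (rule hull_inc)
  have "y0 - c = (y0 - u) + M *\<^sub>R a" by (simp add: c_def)
  hence "q (y0 - c) = q (y0 - u) + M * (2 * gram F a (y0 - u)) + M * (M * q a)"
    unfolding q_def by (simp only: gram_square_add_scaleR)
  also have "M * (2 * gram F a (y0 - u)) \<le> M * (- s)"
    using sep[OF y0H] M by (intro mult_left_mono) auto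
  finally have "q (y0 - c) \<le> q (y0 - u) - (R + 1) + M * (M * q a)"
    using M by simp
  moreover have "q (y0 - u) \<le> R" using y0 u by (intro R) auto
  moreover have "q (u - c) = M * (M * q a)" by (simp add: c_def q_def gram_simps)
  moreover have "q (u - c) < q (y0 - c) + 1" using y0_far[of u] u by auto
  ultimately show False by simp
qed

section \<open>Slices in spaces with the Daugavet property\<close>

lemma dim_range_scaleR:
  fixes x :: "'a::real_normed_vector" and \<psi> :: "'a \<Rightarrow>\<^sub>L real"
  assumes "x \<noteq> 0" "\<psi> \<noteq> 0"
  shows "dim (range (\<lambda>y. blinfun_apply \<psi> y *\<^sub>R x)) = 1"
proof -
  obtain z where z: "blinfun_apply \<psi> z \<noteq> 0"
    using assms(2) by (metis blinfun_eqI zero_blinfun.rep_eq)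
  have "k *\<^sub>R x \<in> range (\<lambda>y. blinfun_apply \<psi> y *\<^sub>R x)" for k
    using z by (intro image_eqI[of _ _ "(k / blinfun_apply \<psi> z) *\<^sub>R z"])
      (auto simp: blinfun.scaleR_right)
  hence "range (\<lambda>y. blinfun_apply \<psi> y *\<^sub>R x) = span {x}"
    by (auto simp: span_singleton)
  moreover have "dim (span {x}) = 1"
    using real_vector.dim_eq_card_independent[of "{x}"] assms(1) by (simp add: real_vector.dim_span)
  ultimately show ?thesis by simp
qed

text \<open>The property is applied to the operator \<open>\<lambda>y. \<rho> y *\<^sub>R x\<close>,
  where \<open>\<rho>\<close> is \<open>\<psi>\<close> normalised. A unit vector that almost attains
  the norm of its sum with the identity must have \<open>\<rho>\<close> almost \<open>1\<close>, so
  it lies in the slice.\<close>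

lemma daugavet_slice:
  fixes x :: "'a::real_normed_vector" and \<psi> :: "'a \<Rightarrow>\<^sub>L real"
  assumes D: "daugavet_property TYPE('a)" and x: "norm x = 1"
    and z: "norm z \<le> 1" "blinfun_apply \<psi> z > \<beta>" and \<epsilon>: "\<epsilon> > 0"
  obtains y where "norm y \<le> 1" "blinfun_apply \<psi> y > \<beta>" "norm (x + y) > 2 - \<epsilon>"
proof (cases "\<psi> = 0")
  case True
  \<comment> \<open>Here \<open>\<beta> < 0\<close>, so \<open>x\<close> itself is in the
    slice.\<close>
  have "norm (x + x) = 2"
    using x by (metis norm_scaleR scaleR_2 abs_numeral mult.right_neutral)
  thus ?thesis using that[of x] True z x \<epsilon> by simp
next
  case False
  define N where "N = norm \<psi>"
  have N: "N > 0" using False by (simp add: N_def)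
  have "N * norm z \<le> N * 1"
    using z N by (intro mult_left_mono) auto
  hence "blinfun_apply \<psi> z \<le> N"
    using norm_blinfun[of \<psi> z] unfolding N_def by simp
  hence \<beta>: "\<beta> / N < 1" using z N by simp
  define \<rho> where "\<rho> = (1 / N) *\<^sub>R \<psi>"
  have \<rho>: "norm \<rho> = 1" "\<rho> \<noteq> 0" using N False by (auto simp: \<rho>_def N_def)
  define T where "T = Blinfun (\<lambda>y. blinfun_apply \<rho> y *\<^sub>R x)"
  have T: "blinfun_apply T = (\<lambda>y. blinfun_apply \<rho> y *\<^sub>R x)"
    unfolding T_def by (intro bounded_linear_Blinfun_apply bounded_linear_intros)
  have "dim (range (blinfun_apply T)) = 1"
    unfolding T using x \<rho> by (intro dim_range_scaleR) auto
  hence IT: "norm (id_blinfun + T) = 1 + norm T"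
    using D by (simp add: daugavet_property_def)
  have "norm (blinfun_apply \<rho> y) \<le> norm T * norm y" for y
    using norm_blinfun[of T y] x by (simp add: T)
  hence "norm \<rho> \<le> norm T"
    by (intro norm_blinfun_bound) auto
  hence T1: "norm (id_blinfun + T) \<ge> 2" using IT \<rho> by simp
  \<comment> \<open>The bound \<open>\<epsilon> / 2\<close> leaves room for two losses of
    \<open>\<eta>\<close>, \<open>1 - \<beta> / N\<close> turns \<open>\<rho> e > 1 - \<eta>\<close>
    into membership in the slice, and \<open>1\<close> keeps \<open>2 - \<eta>\<close>
    positive.\<close>
  define \<eta> where "\<eta> = min (min (\<epsilon> / 2) (1 - \<beta> / N)) 1"
  have \<eta>: "\<eta> > 0" "\<eta> \<le> \<epsilon> / 2" "\<eta> \<le> 1 - \<beta> / N" "\<eta> \<le> 1"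
    using \<epsilon> \<beta> unfolding \<eta>_def by (simp, linarith+)
  have "\<exists>y. norm (y + blinfun_apply \<rho> y *\<^sub>R x) > (2 - \<eta>) * norm y"
  proof (rule ccontr)
    assume "\<not> ?thesis"
    hence "norm (blinfun_apply (id_blinfun + T) y) \<le> (2 - \<eta>) * norm y" for y
      by (auto simp: blinfun.add_left T not_less)
    hence "norm (id_blinfun + T) \<le> 2 - \<eta>"
      using \<eta> by (intro norm_blinfun_bound) auto
    thus False using T1 \<eta> by simp
  qed
  then obtain y where y: "norm (y + blinfun_apply \<rho> y *\<^sub>R x) > (2 - \<eta>) * norm y" by blast
  hence y0: "y \<noteq> 0" by auto
  \<comment> \<open>The sign makes \<open>\<rho> e\<close> nonnegative; it factors out of
    \<open>e + \<rho> e *\<^sub>R x\<close> and leaves the norm unchanged.\<close>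
  define e where "e = (if blinfun_apply \<rho> y \<ge> 0 then 1 / norm y else - 1 / norm y) *\<^sub>R y"
  have e: "norm e = 1" "blinfun_apply \<rho> e \<ge> 0"
    using y0 by (auto simp: e_def blinfun.scaleR_right blinfun.minus_right divide_nonpos_nonneg)
  have "norm (e + blinfun_apply \<rho> e *\<^sub>R x) = norm (y + blinfun_apply \<rho> y *\<^sub>R x) / norm y"
  proof -
    have "e + blinfun_apply \<rho> e *\<^sub>R x =
        (if blinfun_apply \<rho> y \<ge> 0 then 1 / norm y else - 1 / norm y) *\<^sub>R
          (y + blinfun_apply \<rho> y *\<^sub>R x)"
      unfolding e_def by (simp only: blinfun.scaleR_right scaleR_add_right scaleR_scaleR real_scaleR_def)
    thus ?thesis using y0 by simp
  qed
  hence ge: "norm (e + blinfun_apply \<rho> e *\<^sub>R x) > 2 - \<eta>"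
    using y y0 by (simp add: pos_less_divide_eq)
  have "norm (e + blinfun_apply \<rho> e *\<^sub>R x) \<le> 1 + blinfun_apply \<rho> e"
    using norm_triangle_ineq[of e "blinfun_apply \<rho> e *\<^sub>R x"] e x by simp
  hence \<rho>e: "blinfun_apply \<rho> e > 1 - \<eta>" using ge by simp
  have \<rho>e1: "blinfun_apply \<rho> e \<le> 1"
    using norm_blinfun[of \<rho> e] \<rho> e by simp
  have eq: "e + blinfun_apply \<rho> e *\<^sub>R x = (x + e) - (1 - blinfun_apply \<rho> e) *\<^sub>R x"
    by (simp add: algebra_simps)
  have "norm (e + blinfun_apply \<rho> e *\<^sub>R x) \<le> norm (x + e) + (1 - blinfun_apply \<rho> e)"
    unfolding eq using norm_triangle_ineq4[of "x + e" "(1 - blinfun_apply \<rho> e) *\<^sub>R x"] x \<rho>e1 by simp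
  hence "norm (x + e) > 2 - \<epsilon>" using ge \<rho>e \<eta> by simp
  moreover have "blinfun_apply \<psi> e > \<beta>"
  proof -
    have "blinfun_apply \<rho> e = blinfun_apply \<psi> e / N"
      by (simp add: \<rho>_def blinfun.scaleR_left)
    hence "\<beta> / N < blinfun_apply \<psi> e / N" using \<rho>e \<eta> by simp
    thus ?thesis using N by (simp add: divide_less_cancel)
  qed
  ultimately show ?thesis using that[of e] e by simp
qed

text \<open>For \<open>s \<le> t\<close>, \<open>t *\<^sub>R (x + y)\<close> is the combination plus
  \<open>(t - s) *\<^sub>R x\<close>, whose norm is at most \<open>t - s\<close>; the other case is
  symmetric.\<close>

lemma norm_combination_ge:
  fixes x y :: "'a::real_normed_vector"
  assumes "norm x \<le> 1" "norm y \<le> 1" "norm (x + y) \<ge> 2 - \<epsilon>" "s \<ge> 0" "t \<ge> 0"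
  shows "norm (s *\<^sub>R x + t *\<^sub>R y) \<ge> s + t - max s t * \<epsilon>"
proof -
  have *: "norm (s *\<^sub>R x + t *\<^sub>R y) \<ge> s + t - t * \<epsilon>"
    if "norm x \<le> 1" "norm (x + y) \<ge> 2 - \<epsilon>" "0 \<le> s" "s \<le> t" for x y :: 'a and s t
  proof -
    have "t *\<^sub>R (x + y) = (s *\<^sub>R x + t *\<^sub>R y) + (t - s) *\<^sub>R x"
      by (simp add: algebra_simps)
    hence "t * norm (x + y) \<le> norm (s *\<^sub>R x + t *\<^sub>R y) + (t - s) * norm x"
      using norm_triangle_ineq[of "s *\<^sub>R x + t *\<^sub>R y" "(t - s) *\<^sub>R x"] that
      by (metis abs_of_nonneg diff_ge_0_iff_ge norm_scaleR order_trans)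
    moreover have "t * (2 - \<epsilon>) \<le> t * norm (x + y)" "(t - s) * norm x \<le> (t - s) * 1"
      using that by (intro mult_left_mono; simp)+
    ultimately show ?thesis by (simp add: algebra_simps)
  qed
  show ?thesis
  proof (cases "s \<le> t")
    case True
    thus ?thesis using *[of x y s t] assms by (simp add: max_def)
  next
    case False
    thus ?thesis using *[of y x t s] assms by (simp add: max_def add.commute)
  qed
qed

text \<open>The weight \<open>t\<close> and the arbitrary vector \<open>v\<close> are what makes this set convex: a convex combination
  is treated by adding its two terms to \<open>v\<close> in turn.\<close>

definition daugavet_points :: "('a::real_normed_vector \<Rightarrow>\<^sub>L real) set \<Rightarrow> real \<Rightarrow> 'a set" where
  "daugavet_points F \<delta> = {w. \<forall>v t \<epsilon>. t \<ge> 0 \<longrightarrow> \<epsilon> > 0 \<longrightarrow>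
     (\<exists>y. norm y \<le> 1 \<and> (\<forall>\<phi>\<in>F. \<bar>blinfun_apply \<phi> (w - y)\<bar> < \<delta>) \<and>
        norm (v + t *\<^sub>R y) > norm v + t - \<epsilon>)}"

lemma daugavet_pointsE:
  assumes "w \<in> daugavet_points F \<delta>" "t \<ge> 0" "\<epsilon> > 0"
  obtains y where "norm y \<le> 1" "\<forall>\<phi>\<in>F. \<bar>blinfun_apply \<phi> (w - y)\<bar> < \<delta>"
    "norm (v + t *\<^sub>R y) > norm v + t - \<epsilon>"
  using assms unfolding daugavet_points_def by blast

lemma convex_daugavet_points: "convex (daugavet_points F \<delta>)"
proof (rule convexI)
  fix w w' :: 'a and a b :: real
  assume w: "w \<in> daugavet_points F \<delta>" "w' \<in> daugavet_points F \<delta>"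
    and ab: "0 \<le> a" "0 \<le> b" "a + b = 1"
  show "a *\<^sub>R w + b *\<^sub>R w' \<in> daugavet_points F \<delta>"
    unfolding daugavet_points_def
  proof (intro CollectI allI impI)
    fix v :: 'a and t \<epsilon> :: real
    assume t: "t \<ge> 0" and \<epsilon>: "\<epsilon> > 0"
    obtain y where y: "norm y \<le> 1" "\<forall>\<phi>\<in>F. \<bar>blinfun_apply \<phi> (w - y)\<bar> < \<delta>"
        "norm (v + (t * a) *\<^sub>R y) > norm v + t * a - \<epsilon> / 2"
      using daugavet_pointsE[OF w(1), of "t * a" "\<epsilon> / 2" "v"] t ab \<epsilon> by auto
    \<comment> \<open>The second point is chosen against the partial sum that already contains the
      first.\<close>
    obtain y' where y': "norm y' \<le> 1" "\<forall>\<phi>\<in>F. \<bar>blinfun_apply \<phi> (w' - y')\<bar> < \<delta>"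
        "norm ((v + (t * a) *\<^sub>R y) + (t * b) *\<^sub>R y') > norm (v + (t * a) *\<^sub>R y) + t * b - \<epsilon> / 2"
      using daugavet_pointsE[OF w(2), of "t * b" "\<epsilon> / 2" "v + (t * a) *\<^sub>R y"] t ab \<epsilon> by auto
    let ?y = "a *\<^sub>R y + b *\<^sub>R y'"
    have "?y \<in> cball 0 1"
      using y y' ab by (intro convexD[OF convex_cball]) auto
    moreover have "\<bar>blinfun_apply \<phi> ((a *\<^sub>R w + b *\<^sub>R w') - ?y)\<bar> < \<delta>" if "\<phi> \<in> F" for \<phi>
    proof -
      have "a *\<^sub>R blinfun_apply \<phi> (w - y) + b *\<^sub>R blinfun_apply \<phi> (w' - y') \<in> ball 0 \<delta>"
        using y y' ab that by (intro convexD[OF convex_ball]) auto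
      thus ?thesis by (simp add: blinfun.bilinear_simps algebra_simps)
    qed
    moreover have "norm (v + t *\<^sub>R ?y) > norm v + t - \<epsilon>"
    proof -
      have eq: "v + t *\<^sub>R ?y = (v + (t * a) *\<^sub>R y) + (t * b) *\<^sub>R y'"
        by (simp add: algebra_simps)
      have "t * a + t * b = t" using ab by (metis distrib_left mult.right_neutral)
      thus ?thesis unfolding eq using y(3) y'(3) by linarith
    qed
    ultimately show "\<exists>y. norm y \<le> 1 \<and>
        (\<forall>\<phi>\<in>F. \<bar>blinfun_apply \<phi> ((a *\<^sub>R w + b *\<^sub>R w') - y)\<bar> < \<delta>) \<and>
        norm (v + t *\<^sub>R y) > norm v + t - \<epsilon>"
      by (intro exI[of _ ?y]) auto
  qed
qed

text \<open>Every point of the ball in the small slice around \<open>w\<close> is close to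
  \<open>w\<close> on \<open>F\<close>. \<open>daugavet_slice\<close> selects one almost aligned
  with \<open>v\<close>, and \<open>norm_combination_ge\<close> passes to the lengths
  \<open>norm v\<close> and \<open>t\<close>.\<close>

lemma dented_subset_daugavet_points:
  fixes F :: "('a::real_normed_vector \<Rightarrow>\<^sub>L real) set"
  assumes D: "daugavet_property TYPE('a)" and x: "norm (x :: 'a) = 1"
    and F: "finite F" and \<delta>: "\<delta> > 0"
  shows "dented F (\<delta>\<^sup>2) \<subseteq> daugavet_points F \<delta>"
proof
  fix w assume "w \<in> dented F (\<delta>\<^sup>2)"
  then obtain \<psi> :: "'a \<Rightarrow>\<^sub>L real" and \<beta> where w: "norm w \<le> 1" "blinfun_apply \<psi> w > \<beta>"
    and "\<forall>z\<in>cball 0 1. blinfun_apply \<psi> z > \<beta> \<longrightarrow> gram F (z - w) (z - w) < \<delta>\<^sup>2"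
    by (auto simp: dented_def)
  hence dent: "gram F (z - w) (z - w) < \<delta>\<^sup>2" if "norm z \<le> 1" "blinfun_apply \<psi> z > \<beta>" for z
    using that by simp
  show "w \<in> daugavet_points F \<delta>"
    unfolding daugavet_points_def
  proof (intro CollectI allI impI)
    fix v :: 'a and t \<epsilon> :: real
    assume t: "t \<ge> 0" and \<epsilon>: "\<epsilon> > 0"
    \<comment> \<open>The zero vector has no direction, and \<open>x\<close> stands in for
      it.\<close>
    define e where "e = (if v = 0 then x else (1 / norm v) *\<^sub>R v)"
    have e: "norm e = 1" "v = norm v *\<^sub>R e" using x by (auto simp: e_def)
    \<comment> \<open>The error gets multiplied by \<open>max (norm v) t\<close>; the summand
      \<open>1\<close> keeps the denominator positive and the product below
      \<open>\<epsilon>\<close>.\<close>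
    define \<eta> where "\<eta> = \<epsilon> / (norm v + t + 1)"
    have pos: "norm v + t + 1 > 0" using t by (simp add: add_nonneg_pos)
    have \<eta>: "\<eta> > 0" using pos \<epsilon> by (simp add: \<eta>_def)
    obtain y where y: "norm y \<le> 1" "blinfun_apply \<psi> y > \<beta>" "norm (e + y) > 2 - \<eta>"
      using daugavet_slice[OF D e(1) w \<eta>] by blast
    have "max (norm v) t * \<eta> < (norm v + t + 1) * \<eta>"
      using t \<eta> norm_ge_zero[of v] by (intro mult_strict_right_mono) linarith+
    also have "\<dots> = \<epsilon>" using pos by (simp add: \<eta>_def)
    finally have "norm (norm v *\<^sub>R e + t *\<^sub>R y) > norm v + t - \<epsilon>"
      using norm_combination_ge[of e y \<eta> "norm v" t] e y t by simp
    moreover have "\<bar>blinfun_apply \<phi> (w - y)\<bar> < \<delta>" if "\<phi> \<in> F" for \<phi>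
      using gram_less_imp[OF F dent[OF y(1,2)] \<delta> that]
      by (simp add: blinfun.diff_right abs_minus_commute)
    ultimately show "\<exists>y. norm y \<le> 1 \<and> (\<forall>\<phi>\<in>F. \<bar>blinfun_apply \<phi> (w - y)\<bar> < \<delta>) \<and>
        norm (v + t *\<^sub>R y) > norm v + t - \<epsilon>"
      using y(1) e(2) by (intro exI[of _ y]) auto
  qed
qed

section \<open>Weakly open sets: Shvydkoy's theorem\<close>

text \<open>\<open>u\<close> is replaced by \<open>w\<close> in the convex hull, \<open>w\<close> by
  a point \<open>y\<close> of the ball, and \<open>y\<close> by its normalisation \<open>z\<close>.
  Each replacement changes every functional by at most \<open>\<delta>\<close>, less than a third of
  every gap at \<open>u\<close>.\<close>

lemma daugavet_weakly_open:
  fixes x u :: "'a::real_normed_vector" and \<Phi> :: "(('a \<Rightarrow>\<^sub>L real) \<times> real) set"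
  assumes D: "daugavet_property TYPE('a)" and x: "norm x = 1" and u: "norm u = 1"
    and \<Phi>: "finite \<Phi>" "\<forall>k\<in>\<Phi>. blinfun_apply (fst k) u > snd k" and \<epsilon>: "\<epsilon> > 0"
  obtains y where "norm y = 1" "\<forall>k\<in>\<Phi>. blinfun_apply (fst k) y > snd k" "norm (x + y) > 2 - \<epsilon>"
proof -
  define F where "F = fst ` \<Phi>"
  have F: "finite F" using \<Phi> by (simp add: F_def)
  have "\<forall>\<^sub>F d in at_right 0. \<forall>k\<in>\<Phi>. d < (blinfun_apply (fst k) u - snd k) / 3"
    using \<Phi> by (intro eventually_ball_finite ballI order_tendstoD(2)[OF tendsto_ident_at]) auto
  hence "\<forall>\<^sub>F d in at_right (0::real). 0 < d \<and> (\<forall>k\<in>\<Phi>. d < (blinfun_apply (fst k) u - snd k) / 3)"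
    using eventually_at_right_less[of "0::real"] by (intro eventually_conj)
  then obtain \<delta> where \<delta>: "\<delta> > 0" "\<forall>k\<in>\<Phi>. \<delta> < (blinfun_apply (fst k) u - snd k) / 3"
    using eventually_happens'[OF trivial_limit_at_right_real] by blast
  define K where "K = 1 + (\<Sum>\<phi>\<in>F. norm \<phi>)"
  have "norm \<phi> \<le> (\<Sum>\<phi>\<in>F. norm \<phi>)" if "\<phi> \<in> F" for \<phi>
    using F that by (intro member_le_sum) auto
  hence K: "norm \<phi> \<le> K" if "\<phi> \<in> F" for \<phi> using that by (force simp: K_def)
  have K0: "K > 0" by (simp add: K_def add_pos_nonneg sum_nonneg)
  \<comment> \<open>\<open>\<delta> / K\<close> controls the functionals under normalisation,
    \<open>\<epsilon> / 2\<close> allows for two losses in the norm, and \<open>1\<close> excludes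
    \<open>y = 0\<close>.\<close>
  define \<eta> where "\<eta> = min (min (\<epsilon> / 2) (\<delta> / K)) 1"
  have \<eta>: "\<eta> > 0" "\<eta> \<le> \<epsilon> / 2" "\<eta> \<le> 1" "\<eta> \<le> \<delta> / K"
    using \<epsilon> \<delta> K0 unfolding \<eta>_def by (simp, linarith+)
  obtain w where w: "w \<in> convex hull dented F (\<delta>\<^sup>2)" "gram F (u - w) (u - w) < \<delta>\<^sup>2"
    using convex_hull_dented_dense[of u "\<delta>\<^sup>2" "\<delta>\<^sup>2" F] u \<delta> by auto
  have "convex hull dented F (\<delta>\<^sup>2) \<subseteq> daugavet_points F \<delta>"
    by (intro hull_minimal dented_subset_daugavet_points[OF D x F \<delta>(1)] convex_daugavet_points)
  hence "w \<in> daugavet_points F \<delta>" using w by blast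
  then obtain y where y: "norm y \<le> 1" "\<forall>\<phi>\<in>F. \<bar>blinfun_apply \<phi> (w - y)\<bar> < \<delta>"
      "norm (x + 1 *\<^sub>R y) > norm x + 1 - \<eta>"
    using daugavet_pointsE[of w F \<delta> 1 \<eta> x] \<eta>(1) by auto
  have xy: "norm (x + y) > 2 - \<eta>" using y(3) x by simp
  have ny: "norm y > 1 - \<eta>"
    using xy norm_triangle_ineq[of x y] x by simp
  hence y0: "y \<noteq> 0" using \<eta> by auto
  define z where "z = (1 / norm y) *\<^sub>R y"
  have z1: "norm z = 1" using y0 by (simp add: z_def)
  have "y = norm y *\<^sub>R z" using y0 by (simp add: z_def)
  hence "y - z = (norm y - 1) *\<^sub>R z" by (metis scaleR_left.diff scaleR_one)
  hence zy: "norm (y - z) < \<eta>" using z1 ny y(1) by simp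
  have "norm (x + y) \<le> norm (x + z) + norm (y - z)"
    using norm_triangle_ineq[of "x + z" "y - z"] by simp
  hence "norm (x + z) > 2 - \<epsilon>" using xy zy \<eta> by simp
  moreover have "blinfun_apply (fst k) z > snd k" if k: "k \<in> \<Phi>" for k
  proof -
    have kF: "fst k \<in> F" using k by (simp add: F_def)
    have "norm (blinfun_apply (fst k) (y - z)) \<le> norm (fst k) * norm (y - z)"
      by (rule norm_blinfun)
    also have "\<dots> \<le> K * (\<delta> / K)"
      using K[OF kF] K0 zy \<eta> by (intro mult_mono) auto
    finally have "\<bar>blinfun_apply (fst k) (y - z)\<bar> \<le> \<delta>" using K0 by simp
    moreover have "\<bar>blinfun_apply (fst k) (u - w)\<bar> < \<delta>"
      using gram_less_imp[OF F w(2) \<delta>(1) kF] .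
    moreover have "\<bar>blinfun_apply (fst k) (w - y)\<bar> < \<delta>" using y kF by blast
    ultimately show ?thesis
      using bspec[OF \<delta>(2) k] by (simp add: blinfun.diff_right abs_if split: if_splits)
  qed
  ultimately show ?thesis using that z1 by blast
qed

section \<open>Lip-slices of linear functionals and rank-one operators\<close>

lemma lipschitz_const_blinfun:
  fixes \<phi> :: "'a::real_normed_vector \<Rightarrow>\<^sub>L real"
  shows "(norm \<phi>)-lipschitz_on UNIV (blinfun_apply \<phi>)"
    and "lipschitz_const (blinfun_apply \<phi>) = norm \<phi>"
proof -
  have "C-lipschitz_on UNIV (blinfun_apply \<phi>) \<longleftrightarrow> C \<ge> norm \<phi>" for C
  proof
    assume C: "C-lipschitz_on UNIV (blinfun_apply \<phi>)"
    have "norm (blinfun_apply \<phi> y) \<le> C * norm y" for y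
      using lipschitz_onD[OF C, of y 0] by (simp add: dist_norm)
    thus "C \<ge> norm \<phi>"
      using lipschitz_on_nonneg[OF C] by (intro norm_blinfun_bound)
  next
    assume C: "C \<ge> norm \<phi>"
    show "C-lipschitz_on UNIV (blinfun_apply \<phi>)"
    proof (rule lipschitz_onI)
      fix x y
      have "norm (blinfun_apply \<phi> (x - y)) \<le> norm \<phi> * norm (x - y)"
        by (rule norm_blinfun)
      also have "\<dots> \<le> C * norm (x - y)" using C by (intro mult_right_mono) auto
      finally show "dist (blinfun_apply \<phi> x) (blinfun_apply \<phi> y) \<le> C * dist x y"
        by (simp add: dist_norm blinfun.diff_right)
    qed (use C norm_ge_zero order_trans in blast)
  qed
  hence "{C. C-lipschitz_on UNIV (blinfun_apply \<phi>)} = {norm \<phi>..}" by auto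
  thus "(norm \<phi>)-lipschitz_on UNIV (blinfun_apply \<phi>)" "lipschitz_const (blinfun_apply \<phi>) = norm \<phi>"
    by (auto simp: lipschitz_const_def)
qed

text \<open>A difference quotient of \<open>\<phi>\<close> is its value at the normalised
  difference, and a unit vector \<open>y\<close> is the normalised difference of \<open>y\<close>
  and \<open>0\<close>.\<close>

lemma lip_slice_blinfun:
  fixes \<phi> :: "'a::real_normed_vector \<Rightarrow>\<^sub>L real"
  shows "lip_slice (blinfun_apply \<phi>) \<epsilon> = {y. norm y = 1 \<and> blinfun_apply \<phi> y > norm \<phi> - \<epsilon>}"
proof (intro set_eqI iffI)
  fix y assume "y \<in> lip_slice (blinfun_apply \<phi>) \<epsilon>"
  then obtain x1 x2 where "x1 \<noteq> x2" "y = (x1 - x2) /\<^sub>R norm (x1 - x2)"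
      "(blinfun_apply \<phi> x1 - blinfun_apply \<phi> x2) / norm (x1 - x2) > norm \<phi> - \<epsilon>"
    by (auto simp: lip_slice_def lipschitz_const_blinfun)
  thus "y \<in> {y. norm y = 1 \<and> blinfun_apply \<phi> y > norm \<phi> - \<epsilon>}"
    by (simp add: blinfun.scaleR_right blinfun.diff_right divide_inverse mult.commute)
next
  fix y assume "y \<in> {y. norm y = 1 \<and> blinfun_apply \<phi> y > norm \<phi> - \<epsilon>}"
  thus "y \<in> lip_slice (blinfun_apply \<phi>) \<epsilon>"
    unfolding lip_slice_def lipschitz_const_blinfun
    by (intro CollectI exI[of _ y] exI[of _ 0]) auto
qed

text \<open>Otherwise \<open>\<phi>\<close>, and by symmetry its absolute value, is at most
  \<open>norm \<phi> - \<epsilon>\<close> on the sphere, contradicting the norm. The unit vector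
  \<open>b\<close> shows that this bound is nonnegative.\<close>

lemma lip_slice_blinfun_nonempty:
  fixes \<phi> :: "'a::real_normed_vector \<Rightarrow>\<^sub>L real"
  assumes b: "norm (b :: 'a) = 1" and \<epsilon>: "\<epsilon> > 0"
  shows "lip_slice (blinfun_apply \<phi>) \<epsilon> \<noteq> {}"
proof
  assume "lip_slice (blinfun_apply \<phi>) \<epsilon> = {}"
  hence le: "blinfun_apply \<phi> y \<le> norm \<phi> - \<epsilon>" if "norm y = 1" for y
    using that unfolding lip_slice_blinfun by force
  have "- blinfun_apply \<phi> b \<le> norm \<phi> - \<epsilon>"
    using le[of "- b"] b by (simp add: blinfun.minus_right)
  hence "norm \<phi> - \<epsilon> \<ge> 0"
    using le[OF b] by linarith
  moreover have "norm (blinfun_apply \<phi> y) \<le> (norm \<phi> - \<epsilon>) * norm y" for y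
  proof (cases "y = 0")
    case False
    have "\<bar>blinfun_apply \<phi> ((1 / norm y) *\<^sub>R y)\<bar> \<le> norm \<phi> - \<epsilon>"
      using le[of "(1 / norm y) *\<^sub>R y"] le[of "- ((1 / norm y) *\<^sub>R y)"] False
      by (simp add: blinfun.minus_right abs_le_iff)
    thus ?thesis using False by (simp add: blinfun.scaleR_right field_simps)
  qed (simp add: blinfun.zero_right)
  ultimately have "norm \<phi> \<le> norm \<phi> - \<epsilon>" by (intro norm_blinfun_bound)
  thus False using \<epsilon> by simp
qed

text \<open>The functional is the coordinate along a vector spanning the range; normalising that
  vector puts the whole norm of \<open>T\<close> into \<open>\<phi>\<close>.\<close>

lemma rank_one_blinfun:
  fixes T :: "'a::real_normed_vector \<Rightarrow>\<^sub>L 'b::real_normed_vector"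
  assumes "dim (range (blinfun_apply T)) = 1"
  obtains b and \<phi> :: "'a \<Rightarrow>\<^sub>L real"
  where "norm b = 1" "\<And>y. blinfun_apply T y = blinfun_apply \<phi> y *\<^sub>R b" "norm \<phi> = norm T"
proof -
  obtain B where B: "independent B" "range (blinfun_apply T) \<subseteq> span B" "card B = 1"
    using real_vector.basis_exists[of "range (blinfun_apply T)"] assms by metis
  then obtain c where c: "B = {c}" by (auto simp: card_1_singleton_iff)
  hence c0: "c \<noteq> 0" using B(1) by (auto simp: real_vector.dependent_zero)
  define b where "b = (1 / norm c) *\<^sub>R c"
  have b: "norm b = 1" "b \<noteq> 0" using c0 by (auto simp: b_def)
  have "\<exists>k. blinfun_apply T y = k *\<^sub>R b" for y
  proof -
    obtain k where "blinfun_apply T y = k *\<^sub>R c"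
      using B(2) c by (auto simp: span_singleton)
    thus ?thesis using c0 by (intro exI[of _ "k * norm c"]) (simp add: b_def)
  qed
  then obtain g where g: "\<And>y. blinfun_apply T y = g y *\<^sub>R b" by metis
  have "g (x + y) *\<^sub>R b = (g x + g y) *\<^sub>R b" "g (k *\<^sub>R x) *\<^sub>R b = (k * g x) *\<^sub>R b" for x y k
    by (simp_all add: g[symmetric] blinfun.bilinear_simps scaleR_add_left flip: scaleR_scaleR)
  moreover have ng: "norm (g y) = norm (blinfun_apply T y)" for y
    using b by (simp add: g)
  ultimately have "bounded_linear g"
    using b norm_blinfun[of T] by (intro bounded_linear_intro[of _ "norm T"]) (auto simp: mult.commute)
  hence ap: "blinfun_apply (Blinfun g) = g"
    by (rule bounded_linear_Blinfun_apply)
  have "norm (Blinfun g) = norm T"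
    by (simp add: norm_blinfun.rep_eq onorm_def ap ng[simplified])
  thus ?thesis using that b g ap by metis
qed

section \<open>The Daugavet property in terms of Lip-open sets\<close>

theorem corollary2p5:
  shows "daugavet_property TYPE('a::banach) \<longleftrightarrow>
    (\<forall>x\<in>sphere (0::'a) 1. \<forall>U. openin lip_topology U \<and> U \<noteq> {} \<longrightarrow>
       (\<forall>\<epsilon>>0. \<exists>y\<in>U. norm (x + y) > 2 - \<epsilon>))"
proof (intro iffI ballI allI impI)
  fix x :: 'a and U :: "'a set" and \<epsilon> :: real
  assume D: "daugavet_property TYPE('a)" and x: "x \<in> sphere 0 1"
    and U: "openin lip_topology U \<and> U \<noteq> {}" and \<epsilon>: "\<epsilon> > 0"
  obtain u where u: "u \<in> U" using U by blast
  hence u1: "norm u = 1"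
    using U openin_subset[of lip_topology U] by (auto simp: topspace_lip_topology)
  obtain \<Phi> :: "(('a \<Rightarrow>\<^sub>L real) \<times> real) set"
    where \<Phi>: "finite \<Phi>" "\<forall>k\<in>\<Phi>. blinfun_apply (fst k) u > snd k"
      "\<And>y. norm y = 1 \<Longrightarrow> \<forall>k\<in>\<Phi>. blinfun_apply (fst k) y > snd k \<Longrightarrow> y \<in> U"
    using openin_lip_topology_linear_slices[OF conjunct1[OF U] u] by blast
  obtain y where "norm y = 1" "\<forall>k\<in>\<Phi>. blinfun_apply (fst k) y > snd k" "norm (x + y) > 2 - \<epsilon>"
    using daugavet_weakly_open[OF D _ u1 \<Phi>(1,2) \<epsilon>, of x] x by auto
  thus "\<exists>y\<in>U. norm (x + y) > 2 - \<epsilon>" using \<Phi>(3) by blast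
next
  assume R: "\<forall>x\<in>sphere (0::'a) 1. \<forall>U. openin lip_topology U \<and> U \<noteq> {} \<longrightarrow>
       (\<forall>\<epsilon>>0. \<exists>y\<in>U. norm (x + y) > 2 - \<epsilon>)"
  show "daugavet_property TYPE('a)"
    unfolding daugavet_property_def
  proof (intro allI impI antisym)
    fix T :: "'a \<Rightarrow>\<^sub>L 'a"
    assume "dim (range (blinfun_apply T)) = 1"
    then obtain b and \<phi> :: "'a \<Rightarrow>\<^sub>L real"
      where b: "norm b = 1" and T: "\<And>y. blinfun_apply T y = blinfun_apply \<phi> y *\<^sub>R b"
        and N: "norm \<phi> = norm T"
      using rank_one_blinfun by metis
    have "norm (id_blinfun + T) \<le> norm (id_blinfun :: 'a \<Rightarrow>\<^sub>L 'a) + norm T"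
      by (rule norm_triangle_ineq)
    moreover have "norm (id_blinfun :: 'a \<Rightarrow>\<^sub>L 'a) \<le> 1"
      by (intro norm_blinfun_bound) auto
    ultimately show "norm (id_blinfun + T) \<le> 1 + norm T" by simp
    show "1 + norm T \<le> norm (id_blinfun + T)"
    proof (rule field_le_epsilon)
      fix e :: real assume e: "e > 0"
      \<comment> \<open>There are two losses: \<open>max (norm T) 1 * \<epsilon>\<close> from
        combining \<open>b\<close> and \<open>y\<close>, and \<open>\<epsilon>\<close> from
        replacing \<open>norm T\<close> by \<open>\<phi> y\<close>. Together they make
        \<open>K * \<epsilon> = e\<close>.\<close>
      define K where "K = max 1 (norm T) + 1"
      have K: "K > 0" by (simp add: K_def)
      define \<epsilon> where "\<epsilon> = e / K"
      have \<epsilon>: "\<epsilon> > 0" using e K by (simp add: \<epsilon>_def)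
      have "lip_slice (blinfun_apply \<phi>) \<epsilon> \<in> lip_slices"
        unfolding lip_slices_def
        using lipschitz_const_blinfun(1) lip_slice_blinfun_nonempty[OF b \<epsilon>] \<epsilon> by blast
      hence "openin lip_topology (lip_slice (blinfun_apply \<phi>) \<epsilon>)"
        unfolding lip_topology_def by (rule topology_generated_by_Basis)
      \<comment> \<open>The hypothesis is used for the direction \<open>b\<close> of the range and
        the Lip-slice of \<open>\<phi>\<close>, where \<open>T\<close> almost attains its
        norm.\<close>
      hence "\<exists>y\<in>lip_slice (blinfun_apply \<phi>) \<epsilon>. norm (b + y) > 2 - \<epsilon>"
        using R b \<epsilon> lip_slice_blinfun_nonempty[OF b \<epsilon>] by simp
      then obtain y where y: "norm y = 1" "blinfun_apply \<phi> y > norm T - \<epsilon>" "norm (b + y) > 2 - \<epsilon>"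
        unfolding lip_slice_blinfun N by blast
      have \<phi>y: "blinfun_apply \<phi> y \<le> norm T"
        using norm_blinfun[of \<phi> y] y N by simp
      have "norm T *\<^sub>R b + 1 *\<^sub>R y =
          blinfun_apply (id_blinfun + T) y + (norm T - blinfun_apply \<phi> y) *\<^sub>R b"
        by (simp add: blinfun.add_left T algebra_simps)
      hence "norm (norm T *\<^sub>R b + 1 *\<^sub>R y) \<le>
          norm (blinfun_apply (id_blinfun + T) y) + (norm T - blinfun_apply \<phi> y)"
        using norm_triangle_ineq[of "blinfun_apply (id_blinfun + T) y"
            "(norm T - blinfun_apply \<phi> y) *\<^sub>R b"] \<phi>y b by simp
      moreover have "norm (norm T *\<^sub>R b + 1 *\<^sub>R y) \<ge> norm T + 1 - max (norm T) 1 * \<epsilon>"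
        using b y by (intro norm_combination_ge) auto
      moreover have "norm (blinfun_apply (id_blinfun + T) y) \<le> norm (id_blinfun + T)"
        using norm_blinfun[of "id_blinfun + T" y] y by simp
      moreover have "max (norm T) 1 * \<epsilon> + \<epsilon> = e"
      proof -
        have "max (norm T) 1 * \<epsilon> + \<epsilon> = K * \<epsilon>"
          by (simp add: K_def max.commute distrib_right)
        thus ?thesis using K by (simp add: \<epsilon>_def)
      qed
      ultimately show "1 + norm T \<le> norm (id_blinfun + T) + e" using y(2) by linarith
    qed
  qed
qed

end
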